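(* Let $\Theta$ be an inner function. The Beurling subspace $\Theta H^2$ is invariant under the Cesàro operator $\mathcal{C}$ on $H^2$ if and only if $\Theta(z)=\lambda z^n$ for some integer $n\ge 0$ and some $\lambda\in\mathbb{C}$ with $|\lambda|=1$.
   Context: $H^2$ is the Hardy–Hilbert space of the open unit disk $\mathbb{D}$. The Cesàro operator $\mathcal{C}$ on $H^2$ is the bounded operator $(\mathcal{C}f)(z)=\sum_{n=0}^{\infty}\left(\frac{1}{n+1}\sum_{k=0}^{n}a_k\right)z^n$, where $f(z)=\sum_{n\ge 0}a_nz^n$. An inner function is a function $\Theta\in H^2$ whose radial limits have modulus $1$ almost everywhere on the unit circle (unimodular constants are inner). A Beurling subspace is a subspace of the form $\Theta H^2$ with $\Theta$ inner. A subspace $M$ is invariant under $\mathcal{C}$ if $\mathcal{C}M\subseteq M$. *)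

theory Defs
  imports "HOL-Complex_Analysis.Complex_Analysis"
begin

text \<open>
  Functions on the open unit disk are represented by total functions on \<^typ>\<open>complex\<close>
  whose values outside the disk are irrelevant. Every set of functions defined below is closed
  under changing a function outside the disk, and an equation between functions is only
  required to hold on the disk.
\<close>

abbreviation unit_disk :: "complex set" where
  "unit_disk \<equiv> ball 0 1"

definition taylor_coeff :: "(complex \<Rightarrow> complex) \<Rightarrow> nat \<Rightarrow> complex" where
  "taylor_coeff f n = fps_nth (fps_expansion f 0) n"

definition hardy_H2 :: "(complex \<Rightarrow> complex) set" where
  "hardy_H2 = {f. f holomorphic_on unit_disk \<and> summable (\<lambda>n. (norm (taylor_coeff f n))\<^sup>2)}"

definition cesaro :: "(complex \<Rightarrow> complex) \<Rightarrow> complex \<Rightarrow> complex" where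
  "cesaro f z = (\<Sum>n. (1 / of_nat (n + 1) * (\<Sum>k=0..n. taylor_coeff f k)) * z ^ n)"

text \<open>
  The null sets of arc length measure on the unit circle are the images under \<^const>\<open>cis\<close>
  of the Lebesgue null subsets of an interval of length \<open>2 * pi\<close>.
\<close>

definition inner_function :: "(complex \<Rightarrow> complex) \<Rightarrow> bool" where
  "inner_function \<Theta> \<longleftrightarrow> \<Theta> \<in> hardy_H2 \<and>
     (AE t in lebesgue_on {0..2 * pi}.
        \<exists>l. ((\<lambda>r. \<Theta> (of_real r * cis t)) \<longlongrightarrow> l) (at_left (1::real)) \<and> norm l = 1)"

definition beurling_subspace :: "(complex \<Rightarrow> complex) \<Rightarrow> (complex \<Rightarrow> complex) set" where
  "beurling_subspace \<Theta> = {f. \<exists>g\<in>hardy_H2. \<forall>z\<in>unit_disk. f z = \<Theta> z * g z}"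

definition invariant_under ::
    "((complex \<Rightarrow> complex) \<Rightarrow> complex \<Rightarrow> complex) \<Rightarrow> (complex \<Rightarrow> complex) set \<Rightarrow> bool" where
  "invariant_under T M \<longleftrightarrow> T ` M \<subseteq> M"

end

theory Submission
  imports Defs
begin

text \<open>
  If \<open>\<Theta>\<close> is bounded by 1 and \<open>\<Theta> H\<^sup>2\<close> is invariant, then \<open>\<Theta>\<close> divides the image of
  \<open>(1 - z) z\<^sup>j \<Theta>\<close>, which is \<open>z\<^sup>j\<close> times the \<open>j\<close>-th moment of \<open>t \<mapsto> \<Theta> (t z)\<close> on \<open>[0, 1]\<close>. The quotient
  lies in \<open>H\<^sup>2\<close> and has boundary values of modulus at most 1, so it is bounded by 1, i.e. the moment
  term is dominated by \<open>\<bar>\<Theta>\<bar>\<close>. Hence if \<open>\<Theta>\<close> tends to 0 along a sequence converging to \<open>\<zeta> \<noteq> 0\<close> in the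
  closed disk, all moments of \<open>\<Theta>\<close> on the radius to \<open>\<zeta>\<close> vanish and \<open>\<Theta> = 0\<close>. So \<open>\<Theta> = z\<^sup>m S\<close> with \<open>S\<close> bounded
  away from 0, and the maximum principle for \<open>S\<close> and \<open>1 / S\<close> makes \<open>S\<close> constant. No factorisation
  of inner functions is needed. The converse is Hardy's inequality.
\<close>

section \<open>Power series on the unit disk\<close>

lemma taylor_sums:
  assumes "f holomorphic_on unit_disk" "z \<in> unit_disk"
  shows "(\<lambda>n. taylor_coeff f n * z ^ n) sums f z"
  using holomorphic_power_series[OF assms]
  by (simp add: taylor_coeff_def fps_expansion_def)

lemma taylor_coeff_eq:
  assumes "\<And>z. z \<in> unit_disk \<Longrightarrow> (\<lambda>n. c n * z ^ n) sums f z"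
  shows "taylor_coeff f n = c n"
proof -
  \<comment> \<open>Convergence at the single point \<open>1/2\<close> already forces a positive
    radius of convergence; uniqueness of power series expansions at 0 does the rest.\<close>
  have "summable (\<lambda>n. c n * (1/2) ^ n)"
    using assms[of "1/2"] by (simp add: sums_iff)
  from conv_radius_geI[OF this] have "ereal (1/2) \<le> conv_radius c"
    by (simp add: norm_divide)
  then have "0 < conv_radius c"
    by (rule less_le_trans[rotated]) (simp add: zero_ereal_def)
  then have "fps_conv_radius (Abs_fps c) > 0"
    by (simp add: fps_conv_radius_def)
  moreover have "eval_fps (Abs_fps c) z = f z" if "z \<in> unit_disk" for z
    using assms[OF that] by (simp add: eval_fps_def sums_iff)
  then have "eventually (\<lambda>z. eval_fps (Abs_fps c) z = f z) (nhds 0)"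
    by (intro eventually_nhds_in_open[of unit_disk, THEN eventually_mono]) auto
  ultimately have "f has_fps_expansion Abs_fps c"
    by (simp add: has_fps_expansion_def)
  from fps_nth_fps_expansion[OF this, of n] show ?thesis
    by (simp add: taylor_coeff_def fps_expansion_def)
qed

lemma power_series_holomorphic_disk:
  assumes "\<And>z. z \<in> unit_disk \<Longrightarrow> (\<lambda>n. c n * z ^ n) sums f z"
  shows "f holomorphic_on unit_disk"
  by (rule power_series_holomorphic[of 0 1 c]) (use assms in simp)

lemma summable_power_series_bounded:
  fixes c :: "nat \<Rightarrow> complex"
  assumes "\<And>n. norm (c n) \<le> B" "z \<in> unit_disk"
  shows "summable (\<lambda>n. c n * z ^ n)"
proof (rule summable_comparison_test')
  show "summable (\<lambda>n. B * norm z ^ n)"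
    using assms(2) by (intro summable_mult summable_geometric) simp
  show "norm (c n * z ^ n) \<le> B * norm z ^ n" if "n \<ge> 0" for n
    using assms(1)[of n] by (simp add: norm_mult norm_power mult_right_mono)
qed

lemma hardy_H2I:
  assumes "summable (\<lambda>n. (norm (c n))\<^sup>2)"
    and "\<And>z. z \<in> unit_disk \<Longrightarrow> (\<lambda>n. c n * z ^ n) sums f z"
  shows "f \<in> hardy_H2"
  using assms power_series_holomorphic_disk[OF assms(2)] taylor_coeff_eq[OF assms(2)]
  by (simp add: hardy_H2_def)

lemma l2_bounded:
  fixes c :: "nat \<Rightarrow> complex"
  assumes "summable (\<lambda>n. (norm (c n))\<^sup>2)"
  obtains B where "\<And>n. norm (c n) \<le> B"
proof
  fix n
  have "(norm (c n))\<^sup>2 \<le> (\<Sum>n. (norm (c n))\<^sup>2)"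
    using sum_le_suminf[OF assms, of "{n}"] by simp
  then show "norm (c n) \<le> sqrt (\<Sum>n. (norm (c n))\<^sup>2)"
    by (rule real_le_rsqrt)
qed

lemma sums_power_shift:
  fixes c :: "nat \<Rightarrow> complex"
  assumes "(\<lambda>n. c (n + m) * z ^ n) sums s" "\<And>n. n < m \<Longrightarrow> c n = 0"
  shows "(\<lambda>n. c n * z ^ n) sums (z ^ m * s)"
proof -
  have "(\<lambda>n. c (n + m) * z ^ (n + m)) sums (z ^ m * s)"
    using sums_mult[OF assms(1), of "z ^ m"] by (simp add: power_add algebra_simps)
  then show ?thesis
    using assms(2) sums_iff_shift[of "\<lambda>n. c n * z ^ n" m "z ^ m * s"] by simp
qed

lemma sums_power_unshift:
  fixes c :: "nat \<Rightarrow> complex"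
  assumes "(\<lambda>n. c n * z ^ n) sums s"
  shows "(\<lambda>n. (if n < m then 0 else c (n - m)) * z ^ n) sums (z ^ m * s)"
  by (rule sums_power_shift) (use assms in simp_all)

lemma sums_power_divide:
  fixes c :: "nat \<Rightarrow> complex"
  assumes "(\<lambda>n. c n * z ^ n) sums s" "\<And>n. n < m \<Longrightarrow> c n = 0" "z \<noteq> 0"
  shows "(\<lambda>n. c (n + m) * z ^ n) sums (s / z ^ m)"
proof -
  have "(\<lambda>n. c (n + m) * z ^ (n + m)) sums s"
    using assms(1,2) sums_iff_shift[of "\<lambda>n. c n * z ^ n" m s] by simp
  from sums_divide[OF this, of "z ^ m"] show ?thesis
    using assms(3) by (simp add: power_add)
qed

lemma holomorphic_factor_power:
  assumes "f holomorphic_on unit_disk" "\<And>n. n < m \<Longrightarrow> taylor_coeff f n = 0"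
  obtains g where "g holomorphic_on unit_disk" "\<And>n. taylor_coeff g n = taylor_coeff f (n + m)"
    "\<And>z. z \<in> unit_disk \<Longrightarrow> f z = z ^ m * g z"
proof
  define g where "g z = (\<Sum>n. taylor_coeff f (n + m) * z ^ n)" for z
  have g: "(\<lambda>n. taylor_coeff f (n + m) * z ^ n) sums g z" if "z \<in> unit_disk" for z
  proof (cases "z = 0")
    case True
    then show ?thesis
      unfolding g_def by (intro summable_sums summable_finite[of "{0}"]) auto
  next
    case False
    from sums_power_divide[OF taylor_sums[OF assms(1) that] assms(2) this]
    show ?thesis unfolding g_def by (simp add: sums_iff)
  qed
  show "g holomorphic_on unit_disk" by (rule power_series_holomorphic_disk[OF g])
  show "taylor_coeff g n = taylor_coeff f (n + m)" for n by (rule taylor_coeff_eq[OF g])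
  show "f z = z ^ m * g z" if "z \<in> unit_disk" for z
    using sums_power_shift[OF g[OF that] assms(2)] taylor_sums[OF assms(1) that]
    by (simp add: sums_iff)
qed

section \<open>Hardy's inequality\<close>

text \<open>Telescoping: since \<open>a n\<close> is \<open>(n + 1) * A n - n * A (n - 1)\<close>,
  each summand equals \<open>n * (A (n - 1))\<^sup>2 - (n + 1) * (A n)\<^sup>2\<close> minus the
  nonnegative term \<open>n * (A n - A (n - 1))\<^sup>2\<close>.\<close>

lemma hardy_inequality_partial:
  fixes a :: "nat \<Rightarrow> real"
  defines "A \<equiv> \<lambda>n. (\<Sum>k\<le>n. a k) / real (n + 1)"
  shows "(\<Sum>n\<le>N. (A n)\<^sup>2 - 2 * A n * a n) \<le> - real (N + 1) * (A N)\<^sup>2"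
proof (induction N)
  case 0
  then show ?case by (simp add: A_def power2_eq_square)
next
  case (Suc N)
  define p where "p = real (N + 1)"
  have "(x::real)\<^sup>2 - 2 * x * ((p + 1) * x - p * y) + p * (x - y)\<^sup>2 = p * y\<^sup>2 - (p + 1) * x\<^sup>2" for x y
    by algebra
  moreover have "0 \<le> p * (A (Suc N) - A N)\<^sup>2"
    by (simp add: p_def)
  moreover have "(p + 1) * A (Suc N) = (\<Sum>k\<le>Suc N. a k)"
    unfolding A_def p_def by (simp del: sum.atMost_Suc)
  moreover have "p * A N = (\<Sum>k\<le>N. a k)"
    unfolding A_def p_def by simp
  ultimately have "(A (Suc N))\<^sup>2 - 2 * A (Suc N) * a (Suc N) \<le> p * (A N)\<^sup>2 - (p + 1) * (A (Suc N))\<^sup>2"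
    by (smt (verit) sum.atMost_Suc)
  moreover have "real (Suc N + 1) = p + 1" "real (N + 1) = p" by (auto simp: p_def)
  ultimately have "(\<Sum>n\<le>Suc N. (A n)\<^sup>2 - 2 * A n * a n) \<le>
      - (p * (A N)\<^sup>2) + (p * (A N)\<^sup>2 - (p + 1) * (A (Suc N))\<^sup>2)"
    using Suc unfolding sum.atMost_Suc mult_minus_left by (intro add_mono) simp_all
  also have "\<dots> = - real (Suc N + 1) * (A (Suc N))\<^sup>2"
    by (simp add: p_def algebra_simps)
  finally show ?case .
qed

text \<open>The telescoped sum is nonpositive. Estimating its mixed term by
  \<open>2 * x * y \<le> x\<^sup>2 / 2 + 2 * y\<^sup>2\<close> leaves half of the sum of the squared
  means on the left, which is where the constant 4 comes from.\<close>

lemma hardy_inequality_summable: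
  fixes a :: "nat \<Rightarrow> real"
  assumes "summable (\<lambda>n. (a n)\<^sup>2)"
  shows "summable (\<lambda>n. ((\<Sum>k\<le>n. a k) / real (n + 1))\<^sup>2)"
proof -
  define A where "A n = (\<Sum>k\<le>n. a k) / real (n + 1)" for n
  have "(\<Sum>n\<le>N. (A n)\<^sup>2) \<le> 4 * (\<Sum>n. (a n)\<^sup>2)" for N
  proof -
    have "(\<Sum>n\<le>N. (A n)\<^sup>2 / 2 - 2 * (a n)\<^sup>2) \<le> (\<Sum>n\<le>N. (A n)\<^sup>2 - 2 * A n * a n)"
    proof (rule sum_mono)
      fix n
      have "0 \<le> (A n - 2 * a n)\<^sup>2" by simp
      then show "(A n)\<^sup>2 / 2 - 2 * (a n)\<^sup>2 \<le> (A n)\<^sup>2 - 2 * A n * a n"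
        by (simp add: power2_eq_square algebra_simps)
    qed
    also have "\<dots> \<le> - real (N + 1) * (A N)\<^sup>2"
      using hardy_inequality_partial[of a N] by (simp add: A_def)
    also have "\<dots> \<le> 0"
      unfolding mult_minus_left neg_le_0_iff_le by (intro mult_nonneg_nonneg) auto
    finally have "(\<Sum>n\<le>N. (A n)\<^sup>2) \<le> 4 * (\<Sum>n\<le>N. (a n)\<^sup>2)"
      by (simp add: sum_subtractf flip: sum_divide_distrib sum_distrib_left)
    also have "(\<Sum>n\<le>N. (a n)\<^sup>2) \<le> (\<Sum>n. (a n)\<^sup>2)"
      by (rule sum_le_suminf[OF assms]) auto
    finally show ?thesis by simp
  qed
  then have "summable (\<lambda>n. (A n)\<^sup>2)"
    by (intro bounded_imp_summable) auto
  then show ?thesis by (simp add: A_def)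
qed

section \<open>Taylor coefficients of Cesaro images\<close>

definition cesaro_coeff :: "(complex \<Rightarrow> complex) \<Rightarrow> nat \<Rightarrow> complex" where
  "cesaro_coeff f n = 1 / of_nat (n + 1) * (\<Sum>k=0..n. taylor_coeff f k)"

text \<open>The triangle inequality reduces the claim to the real sequence of coefficient norms,
  where Hardy's inequality applies. This is why the Cesaro operator maps \<open>hardy_H2\<close>
  into itself.\<close>

lemma cesaro_coeff_l2:
  assumes "f \<in> hardy_H2"
  shows "summable (\<lambda>n. (norm (cesaro_coeff f n))\<^sup>2)"
proof (rule summable_comparison_test')
  show "summable (\<lambda>n. ((\<Sum>k\<le>n. norm (taylor_coeff f k)) / real (n + 1))\<^sup>2)"
    using assms by (intro hardy_inequality_summable) (simp add: hardy_H2_def)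
  have "norm (cesaro_coeff f n) = norm (\<Sum>k\<le>n. taylor_coeff f k) / real (n + 1)" for n
    unfolding cesaro_coeff_def norm_mult norm_divide norm_of_nat atMost_atLeast0 by simp
  then show "norm ((norm (cesaro_coeff f n))\<^sup>2) \<le> ((\<Sum>k\<le>n. norm (taylor_coeff f k)) / real (n + 1))\<^sup>2"
    if "n \<ge> 0" for n
    by (simp add: norm_sum divide_right_mono power_mono del: of_nat_Suc)
qed

lemma cesaro_sums:
  assumes "f \<in> hardy_H2" "z \<in> unit_disk"
  shows "(\<lambda>n. cesaro_coeff f n * z ^ n) sums cesaro f z"
proof -
  obtain B where "\<And>n. norm (cesaro_coeff f n) \<le> B"
    using l2_bounded[OF cesaro_coeff_l2[OF assms(1)]] by blast
  from summable_sums[OF summable_power_series_bounded[OF this assms(2)]]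
  show ?thesis by (simp add: cesaro_def cesaro_coeff_def)
qed

section \<open>Multiplication by simple factors on the Hardy space\<close>

lemma hardy_H2_times_power:
  assumes "f \<in> hardy_H2"
  shows "(\<lambda>z. z ^ m * f z) \<in> hardy_H2"
proof (rule hardy_H2I)
  let ?c = "\<lambda>n. if n < m then 0 else taylor_coeff f (n - m)"
  have "summable (\<lambda>n. (norm (?c (n + m)))\<^sup>2)"
    using assms by (simp add: hardy_H2_def)
  then show "summable (\<lambda>n. (norm (?c n))\<^sup>2)"
    using summable_iff_shift[of "\<lambda>n. (norm (?c n))\<^sup>2" m] by blast
  show "(\<lambda>n. ?c n * z ^ n) sums (z ^ m * f z)" if "z \<in> unit_disk" for z
    using assms that by (intro sums_power_unshift taylor_sums) (auto simp: hardy_H2_def)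
qed

lemma hardy_H2_cmult:
  assumes "f \<in> hardy_H2"
  shows "(\<lambda>z. c * f z) \<in> hardy_H2"
proof (rule hardy_H2I)
  show "summable (\<lambda>n. (norm (c * taylor_coeff f n))\<^sup>2)"
    using assms by (simp add: hardy_H2_def norm_mult power_mult_distrib summable_mult)
  show "(\<lambda>n. c * taylor_coeff f n * z ^ n) sums (c * f z)" if "z \<in> unit_disk" for z
    using sums_mult[OF taylor_sums[of f z], of c] assms that
    by (simp add: hardy_H2_def mult.assoc)
qed

text \<open>Multiplication by \<open>1 - z\<close> takes consecutive differences of the
  coefficients, so the partial sums inside the Cesaro means telescope back to the coefficients of
  \<open>f\<close>. This makes the Cesaro image of \<open>(1 - z) * f\<close> explicit.\<close>

lemma hardy_H2_times_one_minus:
  assumes "f \<in> hardy_H2"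
  shows "(\<lambda>z. (1 - z) * f z) \<in> hardy_H2"
    and "(\<Sum>k=0..n. taylor_coeff (\<lambda>z. (1 - z) * f z) k) = taylor_coeff f n"
proof -
  \<comment> \<open>The guard matters: truncated subtraction would give
    \<open>taylor_coeff f 0\<close> at \<open>n = 0\<close>, where the shifted series has
    coefficient 0.\<close>
  let ?b = "\<lambda>n. if n < 1 then 0 else taylor_coeff f (n - 1)"
  let ?c = "\<lambda>n. taylor_coeff f n - ?b n"
  have hol: "f holomorphic_on unit_disk" and summ: "summable (\<lambda>n. (norm (taylor_coeff f n))\<^sup>2)"
    using assms by (auto simp: hardy_H2_def)
  have sums: "(\<lambda>n. ?c n * z ^ n) sums ((1 - z) * f z)" if "z \<in> unit_disk" for z
    using sums_diff[OF taylor_sums[OF hol that] sums_power_unshift[OF taylor_sums[OF hol that], of 1]]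
    by (simp add: algebra_simps)
  have "summable (\<lambda>n. (norm (?b (n + 1)))\<^sup>2)"
    using summ by simp
  then have "summable (\<lambda>n. (norm (?b n))\<^sup>2)"
    using summable_iff_shift[of "\<lambda>n. (norm (?b n))\<^sup>2" 1] by blast
  then have "summable (\<lambda>n. 2 * (norm (taylor_coeff f n))\<^sup>2 + 2 * (norm (?b n))\<^sup>2)"
    using summ by (intro summable_add summable_mult)
  then have summ': "summable (\<lambda>n. (norm (?c n))\<^sup>2)"
  proof (rule summable_comparison_test')
    fix n
    have "(norm (?c n))\<^sup>2 \<le> (norm (taylor_coeff f n) + norm (?b n))\<^sup>2"
      by (intro power_mono norm_triangle_ineq4) auto
    also have "\<dots> \<le> 2 * (norm (taylor_coeff f n))\<^sup>2 + 2 * (norm (?b n))\<^sup>2"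
      using sum_squares_bound[of "norm (taylor_coeff f n)" "norm (?b n)"]
      by (simp add: power2_sum)
    finally show "norm ((norm (?c n))\<^sup>2) \<le> 2 * (norm (taylor_coeff f n))\<^sup>2 + 2 * (norm (?b n))\<^sup>2"
      by simp
  qed
  show "(\<lambda>z. (1 - z) * f z) \<in> hardy_H2"
    by (rule hardy_H2I[OF summ' sums])
  have "(\<Sum>k=0..n. ?c k) = taylor_coeff f n"
    by (induction n) auto
  then show "(\<Sum>k=0..n. taylor_coeff (\<lambda>z. (1 - z) * f z) k) = taylor_coeff f n"
    by (subst sum.cong[OF refl taylor_coeff_eq[OF sums]])
qed

lemma one_in_hardy_H2: "(\<lambda>_. 1) \<in> hardy_H2"
proof (rule hardy_H2I)
  show "summable (\<lambda>n. (norm (if n = 0 then 1 else 0 :: complex))\<^sup>2)"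
    by (intro summable_finite[of "{0}"]) auto
  show "(\<lambda>n. (if n = 0 then 1 else 0) * z ^ n) sums 1" for z :: complex
    using sums_finite[of "{0}" "\<lambda>n. (if n = 0 then 1 else 0) * z ^ n"] by simp
qed

text \<open>Members of the subspace have vanishing coefficients below \<open>m\<close>, and then so
  do their Cesaro means. Hardy's inequality keeps the remaining means square-summable, so
  \<open>z ^ m\<close> can be divided out again; the constant \<open>c\<close> is absorbed by its
  inverse.\<close>

lemma invariant_beurling_monomial:
  assumes c: "norm c = 1" and \<Theta>: "\<And>z. z \<in> unit_disk \<Longrightarrow> \<Theta> z = c * z ^ m"
  shows "invariant_under cesaro (beurling_subspace \<Theta>)"
  unfolding invariant_under_def
proof (rule image_subsetI)
  fix f assume "f \<in> beurling_subspace \<Theta>"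
  then obtain g where g: "g \<in> hardy_H2" and f: "\<And>z. z \<in> unit_disk \<Longrightarrow> f z = z ^ m * (c * g z)"
    using \<Theta> unfolding beurling_subspace_def by force
  let ?g = "\<lambda>z. c * g z"
  have gH: "?g \<in> hardy_H2" using g by (rule hardy_H2_cmult)
  have sums: "(\<lambda>n. (if n < m then 0 else taylor_coeff ?g (n - m)) * z ^ n) sums f z"
    if "z \<in> unit_disk" for z
    using sums_power_unshift[OF taylor_sums[of ?g z], of m] gH that f[OF that]
    by (simp add: hardy_H2_def)
  have coeff: "taylor_coeff f n = (if n < m then 0 else taylor_coeff ?g (n - m))" for n
    by (rule taylor_coeff_eq[OF sums])
  have "summable (\<lambda>n. (norm (taylor_coeff f (n + m)))\<^sup>2)"
    using gH by (simp add: coeff hardy_H2_def)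
  then have fH: "f \<in> hardy_H2"
    using power_series_holomorphic_disk[OF sums] summable_iff_shift[of "\<lambda>n. (norm (taylor_coeff f n))\<^sup>2" m]
    by (simp add: hardy_H2_def)
  have zero: "cesaro_coeff f n = 0" if "n < m" for n
    using that by (simp add: cesaro_coeff_def coeff)
  have l2: "summable (\<lambda>n. (norm (cesaro_coeff f (n + m)))\<^sup>2)"
    using cesaro_coeff_l2[OF fH] summable_iff_shift[of "\<lambda>n. (norm (cesaro_coeff f n))\<^sup>2" m] by blast
  obtain B where B: "\<And>n. norm (cesaro_coeff f (n + m)) \<le> B"
    using l2_bounded[OF l2] by blast
  define h where "h z = (\<Sum>n. cesaro_coeff f (n + m) * z ^ n)" for z
  have h: "(\<lambda>n. cesaro_coeff f (n + m) * z ^ n) sums h z" if "z \<in> unit_disk" for z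
    unfolding h_def using summable_sums[OF summable_power_series_bounded[OF B that]] .
  have "h \<in> hardy_H2" by (rule hardy_H2I[OF l2 h])
  then have "(\<lambda>z. inverse c * h z) \<in> hardy_H2" by (rule hardy_H2_cmult)
  moreover have "cesaro f z = \<Theta> z * (inverse c * h z)" if "z \<in> unit_disk" for z
  proof -
    have "cesaro f z = z ^ m * h z"
      using sums_power_shift[OF h[OF that] zero] cesaro_sums[OF fH that] by (simp add: sums_iff)
    moreover have "c \<noteq> 0" using c by auto
    ultimately show ?thesis using \<Theta>[OF that] by simp
  qed
  ultimately show "cesaro f \<in> beurling_subspace \<Theta>"
    unfolding beurling_subspace_def by (intro CollectI bexI[of _ "\<lambda>z. inverse c * h z"] ballI)
qed

section \<open>Means over circles\<close>

text \<open>Orthogonality of characters: for \<open>n \<noteq> m\<close> the integrand is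
  \<open>cis (k * t)\<close> with a nonzero integer \<open>k\<close>, and its antiderivative takes
  equal values at both endpoints.\<close>

lemma cis_power_integral:
  "((\<lambda>t. cis t ^ n * cnj (cis t ^ m)) has_integral (if n = m then of_real (2 * pi) else 0)) {0..2 * pi}"
proof -
  have eq: "cis t ^ n * cnj (cis t ^ m) = cis ((real n - real m) * t)" for t
    by (simp add: Complex.DeMoivre cis_cnj cis_mult algebra_simps)
  show ?thesis
  proof (cases "n = m")
    case True
    then show ?thesis
      using has_integral_const_real[of "1 :: complex" 0 "2 * pi"]
      unfolding eq by (simp add: scaleR_conv_of_real)
  next
    case False
    define k where "k = real n - real m"
    have k: "k \<noteq> 0" using False by (simp add: k_def)
    have "((\<lambda>t. cis (k * t)) has_integral
        (cis (k * (2 * pi)) / (\<i> * k) - cis (k * 0) / (\<i> * k))) {0..2 * pi}"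
    proof (rule fundamental_theorem_of_calculus)
      fix t :: real
      have "((\<lambda>w. exp (\<i> * k * w) / (\<i> * k)) has_field_derivative exp (\<i> * k * of_real t))
          (at (of_real t))"
        using k by (auto intro!: derivative_eq_intros)
      from has_vector_derivative_real_field[OF this, of "{0..2 * pi}"]
      show "((\<lambda>t. cis (k * t) / (\<i> * k)) has_vector_derivative cis (k * t)) (at t within {0..2 * pi})"
        by (simp add: cis_conv_exp algebra_simps)
    qed simp
    moreover have "cis (k * (2 * pi)) = 1"
      using cis_multiple_2pi[of k] by (simp add: k_def mult.commute mult.left_commute)
    ultimately show ?thesis
      using False unfolding eq k_def[symmetric] by simp
  qed
qed

text \<open>The squared modulus is expanded into a double sum over products with conjugates;
  orthogonality leaves only the diagonal.\<close>

lemma parseval_polynomial: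
  "((\<lambda>t. (norm (\<Sum>n<N. c n * cis t ^ n))\<^sup>2) has_integral 2 * pi * (\<Sum>n<N. (norm (c n))\<^sup>2)) {0..2 * pi}"
proof -
  have "((\<lambda>t. \<Sum>n<N. \<Sum>m<N. (c n * cnj (c m)) * (cis t ^ n * cnj (cis t ^ m))) has_integral
      (\<Sum>n<N. \<Sum>m<N. (c n * cnj (c m)) * (if n = m then of_real (2 * pi) else 0))) {0..2 * pi}"
    by (intro has_integral_sum has_integral_mult_right cis_power_integral) auto
  also have "(\<lambda>t. \<Sum>n<N. \<Sum>m<N. (c n * cnj (c m)) * (cis t ^ n * cnj (cis t ^ m))) =
      (\<lambda>t. of_real ((norm (\<Sum>n<N. c n * cis t ^ n))\<^sup>2))"
    by (simp add: complex_norm_square sum_product fun_eq_iff mult_ac del: of_real_power)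
  also have "(\<Sum>n<N. \<Sum>m<N. (c n * cnj (c m)) * (if n = m then of_real (2 * pi) else 0)) =
      of_real (2 * pi * (\<Sum>n<N. (norm (c n))\<^sup>2))"
    by (simp add: complex_norm_square sum_distrib_left if_distrib mult_ac del: of_real_power cong: if_cong)
  finally have "((\<lambda>t. of_real ((norm (\<Sum>n<N. c n * cis t ^ n))\<^sup>2)) has_integral
      complex_of_real (2 * pi * (\<Sum>n<N. (norm (c n))\<^sup>2))) {0..2 * pi}" .
  from has_integral_Re[OF this] show ?thesis
    by (simp only: Re_complex_of_real)
qed

text \<open>Parseval for the partial sums passes to the limit by dominated convergence. The bound
  does not depend on \<open>r\<close>, which is what the boundary maximum principle
  requires.\<close>

lemma circle_mean_bound:
  assumes sums: "\<And>z. z \<in> unit_disk \<Longrightarrow> (\<lambda>n. a n * z ^ n) sums h z"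
    and l2: "summable (\<lambda>n. (norm (a n))\<^sup>2)" and r: "0 \<le> r" "r < 1"
  shows "integral {0..2 * pi} (\<lambda>t. (norm (h (of_real r * cis t)))\<^sup>2) \<le> 2 * pi * (\<Sum>n. (norm (a n))\<^sup>2)"
proof -
  define c where "c n = a n * of_real r ^ n" for n
  have summ: "summable (\<lambda>n. norm (c n))"
  proof -
    \<comment> \<open>The midpoint of \<open>r\<close> and 1 is a point of convergence beyond
      \<open>r\<close>, so the series converges absolutely at radius \<open>r\<close>.\<close>
    have "summable (\<lambda>n. a n * of_real ((r + 1) / 2) ^ n)"
      using sums[of "of_real ((r + 1) / 2)"] r by (simp add: sums_iff norm_divide flip: of_real_add)
    from powser_insidea[OF this, of "of_real r"] show ?thesis
      using r by (simp add: c_def)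
  qed
  define f where "f N t = (norm (\<Sum>n<N. c n * cis t ^ n))\<^sup>2" for N t
  have f: "(f N has_integral 2 * pi * (\<Sum>n<N. (norm (c n))\<^sup>2)) {0..2 * pi}" for N
    unfolding f_def by (rule parseval_polynomial)
  have bound: "norm (f N t) \<le> (\<Sum>n. norm (c n))\<^sup>2" for N t
  proof -
    have "norm (\<Sum>n<N. c n * cis t ^ n) \<le> (\<Sum>n<N. norm (c n))"
      by (rule order_trans[OF norm_sum]) (simp add: norm_mult norm_power)
    also have "\<dots> \<le> (\<Sum>n. norm (c n))"
      by (rule sum_le_suminf[OF summ]) auto
    finally show ?thesis
      by (simp add: f_def power_mono)
  qed
  have conv: "(\<lambda>N. f N t) \<longlonglongrightarrow> (norm (h (of_real r * cis t)))\<^sup>2" for t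
  proof -
    have "(\<lambda>n. c n * cis t ^ n) sums h (of_real r * cis t)"
      using sums[of "of_real r * cis t"] r by (simp add: c_def power_mult_distrib mult.assoc norm_mult)
    then show ?thesis
      unfolding f_def sums_def by (intro tendsto_intros)
  qed
  have "(\<lambda>N. integral {0..2 * pi} (f N)) \<longlonglongrightarrow>
      integral {0..2 * pi} (\<lambda>t. (norm (h (of_real r * cis t)))\<^sup>2)"
  proof (rule dominated_convergence(2))
    show "f N integrable_on {0..2 * pi}" for N using f by (rule has_integral_integrable)
    show "(\<lambda>_. (\<Sum>n. norm (c n))\<^sup>2) integrable_on {0..2 * pi}" by (rule integrable_const_ivl)
  qed (use bound conv in auto)
  moreover have "integral {0..2 * pi} (f N) \<le> 2 * pi * (\<Sum>n. (norm (a n))\<^sup>2)" for N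
  proof -
    have "(\<Sum>n<N. (norm (c n))\<^sup>2) \<le> (\<Sum>n<N. (norm (a n))\<^sup>2)"
    proof (rule sum_mono)
      fix n
      have "norm (c n) \<le> norm (a n) * 1"
        unfolding c_def norm_mult norm_power using r by (intro mult_left_mono power_le_one) auto
      then show "(norm (c n))\<^sup>2 \<le> (norm (a n))\<^sup>2"
        by (simp add: power_mono)
    qed
    also have "\<dots> \<le> (\<Sum>n. (norm (a n))\<^sup>2)"
      by (rule sum_le_suminf[OF l2]) auto
    finally show ?thesis
      using integral_unique[OF f[of N]] by simp
  qed
  ultimately show ?thesis
    by (intro LIMSEQ_le_const2) auto
qed

section \<open>Poisson kernel and Poisson formula\<close>

definition poisson :: "complex \<Rightarrow> real \<Rightarrow> real" where
  "poisson z t = (1 - (norm z)\<^sup>2) / (norm (1 - cnj z * cis t))\<^sup>2"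

text \<open>This makes the denominator of the Poisson kernel harmless, and makes
  \<open>1 / (1 - cnj z * u)\<close> holomorphic in \<open>u\<close> up to the unit circle, so that
  Cauchy's formula can be applied to the quotient.\<close>

lemma one_minus_disk_nonzero:
  assumes "z \<in> unit_disk" "norm w \<le> 1"
  shows "1 - cnj z * w \<noteq> 0"
proof
  assume "1 - cnj z * w = 0"
  then have "norm (cnj z * w) = 1" by (metis eq_iff_diff_eq_0 norm_one)
  moreover have "norm (cnj z * w) \<le> norm z * 1"
    using assms(2) by (simp add: norm_mult mult_left_le)
  ultimately show False using assms(1) by simp
qed

text \<open>
  Dividing by \<open>1 - cnj z * u\<close> turns the Cauchy kernel into the Poisson kernel,
  since \<open>u / (u - z)\<close> is the conjugate of \<open>1 / (1 - cnj z * u)\<close> on the unit circle.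
\<close>

lemma poisson_formula:
  assumes h: "h holomorphic_on unit_disk" and r: "0 \<le> r" "r < 1" and z: "z \<in> unit_disk"
  shows "((\<lambda>t. h (of_real r * cis t) * of_real (poisson z t)) has_integral
    2 * of_real pi * h (of_real r * z)) {0..2 * pi}"
proof -
  have nz: "1 - cnj z * u \<noteq> 0" if "norm u \<le> 1" for u
    using one_minus_disk_nonzero[OF z that] .
  \<comment> \<open>Dilation by \<open>r < 1\<close> brings the closed disk into the domain of
    \<open>h\<close>, so Cauchy's formula can be used on the unit circle itself.\<close>
  have "(\<lambda>u. h (of_real r * u)) holomorphic_on cball 0 1"
  proof -
    have "(h \<circ> (\<lambda>u. of_real r * u)) holomorphic_on cball 0 1"
    proof (rule holomorphic_on_compose_gen[OF _ h])
      show "(\<lambda>u. of_real r * u) ` cball 0 1 \<subseteq> unit_disk"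
      proof clarsimp
        fix u :: complex assume "norm u \<le> 1"
        then have "r * norm u \<le> r" using r by (simp add: mult_left_le)
        then show "norm (of_real r * u) < 1" using r by (simp add: norm_mult)
      qed
    qed (intro holomorphic_intros)
    then show ?thesis by (simp add: o_def)
  qed
  then have "(\<lambda>u. h (of_real r * u) / (1 - cnj z * u)) holomorphic_on cball 0 1"
    using nz by (intro holomorphic_intros) auto
  from Cauchy_integral_circlepath_simple[OF this, of z]
  have "((\<lambda>t. h (of_real r * cis t) / (1 - cnj z * cis t) / (cis t - z) * \<i> * cis t) has_integral
      2 * of_real pi * \<i> * (h (of_real r * z) / (1 - cnj z * z))) {0..2 * pi}"
    using z by (simp add: circlepath_def has_contour_integral_part_circlepath_iff)
  \<comment> \<open>The factor cancels the auxiliary divisor at \<open>u = z\<close> together with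
    the \<open>\<i>\<close> from the contour derivative, and supplies the numerator of the Poisson
    kernel.\<close>
  from has_integral_mult_right[OF this, of "(1 - cnj z * z) / \<i>"]
  have "((\<lambda>t. (1 - cnj z * z) / \<i> *
        (h (of_real r * cis t) / (1 - cnj z * cis t) / (cis t - z) * \<i> * cis t)) has_integral
      (1 - cnj z * z) / \<i> * (2 * of_real pi * \<i> * (h (of_real r * z) / (1 - cnj z * z)))) {0..2 * pi}" .
  moreover have "(1 - cnj z * z) / \<i> * (2 * of_real pi * \<i> * (h (of_real r * z) / (1 - cnj z * z))) =
      2 * of_real pi * h (of_real r * z)"
    using nz[of z] z by (simp add: field_simps)
  moreover have "(1 - cnj z * z) / \<i> *
      (h (of_real r * cis t) / (1 - cnj z * cis t) / (cis t - z) * \<i> * cis t) =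
      h (of_real r * cis t) * of_real (poisson z t)" for t
  proof -
    have "cis t - z = cis t * cnj (1 - cnj z * cis t)"
      by (simp add: algebra_simps cis_cnj cis_mult flip: mult.assoc)
    moreover have "complex_of_real (poisson z t) =
        (1 - cnj z * z) / ((1 - cnj z * cis t) * cnj (1 - cnj z * cis t))"
      by (simp add: poisson_def complex_norm_square mult.commute[of z]
          del: complex_cnj_diff complex_cnj_mult of_real_power)
    moreover have "a / \<i> * (b / D / (w * E) * \<i> * w) = b * (a / (D * E))" if "w \<noteq> 0" for a b D E w :: complex
      using that by (simp add: mult.commute mult.left_commute)
    ultimately show ?thesis by (simp only: cis_neq_zero not_False_eq_True)
  qed
  ultimately show ?thesis by simp
qed

lemma poisson_nonneg: "z \<in> unit_disk \<Longrightarrow> poisson z t \<ge> 0"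
  by (simp add: poisson_def power_le_one)

lemma poisson_le:
  assumes "z \<in> unit_disk"
  shows "poisson z t \<le> 1 / (1 - norm z)\<^sup>2"
proof -
  have "1 - norm z \<le> norm (1 - cnj z * cis t)"
    using norm_triangle_ineq2[of 1 "cnj z * cis t"] by (simp add: norm_mult)
  then show ?thesis
    using assms unfolding poisson_def
    by (intro frac_le power_mono) auto
qed

lemma continuous_poisson:
  assumes "z \<in> unit_disk"
  shows "continuous_on A (poisson z)"
  unfolding poisson_def using one_minus_disk_nonzero[OF assms]
  by (intro continuous_intros) auto

text \<open>The Poisson formula for the constant function 1, taken at \<open>r = 0\<close>.\<close>

lemma poisson_integral:
  assumes "z \<in> unit_disk"
  shows "(poisson z has_integral 2 * pi) {0..2 * pi}"
  using has_integral_Re[OF poisson_formula[of "\<lambda>_. 1" 0 z]] assms by simp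

section \<open>Maximum principle from radial boundary bounds\<close>

text \<open>
  The truncated modulus is bounded, so dominated convergence applies to it, and the part
  above the truncation level \<open>1 / d\<close> is at most \<open>d\<close> times the square of the modulus.
\<close>

lemma boundary_maximum_principle:
  assumes h: "h holomorphic_on unit_disk"
    and mean: "\<And>r. 0 \<le> r \<Longrightarrow> r < 1 \<Longrightarrow> integral {0..2 * pi} (\<lambda>t. (norm (h (of_real r * cis t)))\<^sup>2) \<le> B"
    and bdry: "AE t in lebesgue_on {0..2 * pi}.
      \<forall>e>0. \<forall>\<^sub>F r in at_left (1::real). norm (h (of_real r * cis t)) \<le> M + e"
    and M: "0 \<le> M" and z: "z \<in> unit_disk"
  shows "norm (h z) \<le> M"
proof -
  define C where "C = 1 / (1 - norm z)\<^sup>2"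
  have P: "0 \<le> poisson z t" "poisson z t \<le> C" for t
    using poisson_nonneg[OF z] poisson_le[OF z] by (auto simp: C_def)
  define r where "r n = 1 - 1 / (real n + 1)" for n
  have r: "0 \<le> r n" "r n < 1" for n by (auto simp: r_def)
  have r_lim: "r \<longlonglongrightarrow> 1" unfolding r_def by real_asymp
  then have r_left: "filterlim r (at_left 1) sequentially"
    using r by (auto simp: filterlim_at less_imp_neq intro!: always_eventually)
  define u where "u n t = norm (h (of_real (r n) * cis t))" for n t
  have cont_u: "continuous_on A (u n)" for A n
  proof -
    have "of_real (r n) * cis t \<in> unit_disk" for t using r[of n] by (simp add: norm_mult)
    then have "continuous_on A (\<lambda>t. h (of_real (r n) * cis t))"
      by (intro continuous_on_compose2[OF holomorphic_on_imp_continuous_on[OF h]] continuous_intros) auto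
    then show ?thesis unfolding u_def by (intro continuous_intros)
  qed
  have mean_u: "integral {0..2 * pi} (\<lambda>t. (u n t)\<^sup>2) \<le> B" for n
    unfolding u_def by (rule mean[OF r])
  \<comment> \<open>For fixed \<open>d\<close> the radius tends to 1 first; only afterwards does
    \<open>d\<close> tend to 0, which removes the error term because \<open>C\<close> and
    \<open>B\<close> are independent of \<open>d\<close>.\<close>
  have est: "2 * pi * norm (h z) \<le> 2 * pi * M + C * d * B" if d: "d > 0" for d
  proof -
    \<comment> \<open>The boundary hypothesis only bounds the modulus from above asymptotically, so
      it need not have a limit. Taking the maximum with \<open>M\<close> forces convergence to
      exactly \<open>M\<close>, while the minimum with \<open>1 / d\<close> gives
      domination.\<close>
    define v where "v n t = poisson z t * max M (min (u n t) (1 / d))" for n t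
    have cont_v: "continuous_on A (v n)" for A n
      unfolding v_def by (intro continuous_intros continuous_poisson[OF z] cont_u)
    have step: "2 * pi * norm (h (of_real (r n) * z)) \<le> integral {0..2 * pi} (v n) + C * d * B" for n
    proof -
      have "v n t + C * d * (u n t)\<^sup>2 \<ge> poisson z t * u n t" for t
      proof -
        have "u n t \<le> max M (min (u n t) (1 / d)) + d * (u n t)\<^sup>2"
        proof (cases "u n t \<le> 1 / d")
          case True
          have "0 \<le> d * (u n t)\<^sup>2" using d by simp
          then show ?thesis using True by simp
        next
          case False
          then have "1 \<le> d * u n t" using d by (simp add: field_simps)
          then have "1 * u n t \<le> d * u n t * u n t"
            by (rule mult_right_mono) (simp add: u_def)
          moreover have "0 \<le> max M (min (u n t) (1 / d))" using M by simp
          ultimately show ?thesis by (simp add: power2_eq_square)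
        qed
        then have "poisson z t * u n t \<le> v n t + poisson z t * (d * (u n t)\<^sup>2)"
          unfolding v_def distrib_left[symmetric] by (rule mult_left_mono[OF _ P(1)])
        also have "poisson z t * (d * (u n t)\<^sup>2) \<le> C * (d * (u n t)\<^sup>2)"
          using d by (intro mult_right_mono P) auto
        finally show ?thesis by (simp add: mult.assoc)
      qed
      note le = this
      have int: "(\<lambda>t. v n t + C * d * (u n t)\<^sup>2) integrable_on {0..2 * pi}"
        by (intro integrable_continuous_real continuous_intros cont_v cont_u)
      have "2 * pi * norm (h (of_real (r n) * z)) =
          norm (integral {0..2 * pi} (\<lambda>t. h (of_real (r n) * cis t) * of_real (poisson z t)))"
        using integral_unique[OF poisson_formula[OF h r z]] by (simp add: norm_mult)
      also have "\<dots> \<le> integral {0..2 * pi} (\<lambda>t. v n t + C * d * (u n t)\<^sup>2)"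
      proof (rule integral_norm_bound_integral[OF _ int])
        show "(\<lambda>t. h (of_real (r n) * cis t) * of_real (poisson z t)) integrable_on {0..2 * pi}"
          using poisson_formula[OF h r z] by (rule has_integral_integrable)
        show "norm (h (of_real (r n) * cis t) * of_real (poisson z t)) \<le> v n t + C * d * (u n t)\<^sup>2" for t
          using le[of t] P(1)[of t] by (simp add: norm_mult u_def mult.commute)
      qed
      also have "\<dots> = integral {0..2 * pi} (v n) + C * d * integral {0..2 * pi} (\<lambda>t. (u n t)\<^sup>2)"
      proof (subst integral_add)
        show "v n integrable_on {0..2 * pi}" "(\<lambda>t. C * d * (u n t)\<^sup>2) integrable_on {0..2 * pi}"
          by (intro integrable_continuous_real continuous_intros cont_v cont_u)+
      qed simp
      also have "\<dots> \<le> integral {0..2 * pi} (v n) + C * d * B"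
        using d P[of 0] mean_u[of n] by (intro add_left_mono mult_left_mono mult_nonneg_nonneg) auto
      finally show ?thesis .
    qed
    have "(\<lambda>n. integral\<^sup>L (lebesgue_on {0..2 * pi}) (v n)) \<longlonglongrightarrow>
        integral\<^sup>L (lebesgue_on {0..2 * pi}) (\<lambda>t. poisson z t * M)"
    proof (rule integral_dominated_convergence)
      show "(\<lambda>t. poisson z t * M) \<in> borel_measurable (lebesgue_on {0..2 * pi})"
        "integrable (lebesgue_on {0..2 * pi}) (\<lambda>t. poisson z t * max M (1 / d))"
        by (intro borel_measurable_integrable continuous_imp_integrable_real continuous_intros
            continuous_poisson[OF z])+
      show "v n \<in> borel_measurable (lebesgue_on {0..2 * pi})" for n
        by (intro borel_measurable_integrable continuous_imp_integrable_real cont_v)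
      show "AE t in lebesgue_on {0..2 * pi}. norm (v n t) \<le> poisson z t * max M (1 / d)" for n
      proof (rule AE_I2)
        fix t
        have "0 \<le> max M (min (u n t) (1 / d))" using M by simp
        then show "norm (v n t) \<le> poisson z t * max M (1 / d)"
          using P(1)[of t] by (auto simp: v_def abs_mult intro!: mult_left_mono)
      qed
      show "AE t in lebesgue_on {0..2 * pi}. (\<lambda>n. v n t) \<longlonglongrightarrow> poisson z t * M"
        using bdry
      proof eventually_elim
        fix t assume t: "\<forall>e>0. \<forall>\<^sub>F r in at_left (1::real). norm (h (of_real r * cis t)) \<le> M + e"
        have "(\<lambda>n. max M (min (u n t) (1 / d))) \<longlonglongrightarrow> M"
        proof (rule LIMSEQ_I)
          fix e :: real assume e: "e > 0"
          then have "\<forall>\<^sub>F r in at_left (1::real). norm (h (of_real r * cis t)) \<le> M + e / 2"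
            using t by simp
          then have "\<forall>\<^sub>F n in sequentially. u n t \<le> M + e / 2"
            unfolding u_def by (rule eventually_compose_filterlim[OF _ r_left])
          then have "\<forall>\<^sub>F n in sequentially. norm (max M (min (u n t) (1 / d)) - M) < e"
            by eventually_elim (use e in auto)
          then show "\<exists>no. \<forall>n\<ge>no. norm (max M (min (u n t) (1 / d)) - M) < e"
            by (simp add: eventually_sequentially)
        qed
        then show "(\<lambda>n. v n t) \<longlonglongrightarrow> poisson z t * M"
          unfolding v_def by (intro tendsto_intros)
      qed
    qed
    moreover have "integral\<^sup>L (lebesgue_on {0..2 * pi}) (v n) = integral {0..2 * pi} (v n)" for n
      by (intro lebesgue_integral_eq_integral continuous_imp_integrable_real cont_v) auto
    moreover have "integral\<^sup>L (lebesgue_on {0..2 * pi}) (\<lambda>t. poisson z t * M) = 2 * pi * M"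
      using integral_unique[OF has_integral_mult_left[OF poisson_integral[OF z], of M]]
      by (subst lebesgue_integral_eq_integral)
        (auto intro!: continuous_imp_integrable_real continuous_intros continuous_poisson[OF z])
    ultimately have "(\<lambda>n. integral {0..2 * pi} (v n)) \<longlonglongrightarrow> 2 * pi * M"
      by (simp only:)
    then have upper: "(\<lambda>n. integral {0..2 * pi} (v n) + C * d * B) \<longlonglongrightarrow> 2 * pi * M + C * d * B"
      by (intro tendsto_intros)
    have lower: "(\<lambda>n. 2 * pi * norm (h (of_real (r n) * z))) \<longlonglongrightarrow> 2 * pi * norm (h z)"
    proof -
      have "isCont h z"
        using h z holomorphic_on_imp_continuous_on continuous_on_eq_continuous_at open_ball by blast
      moreover have "(\<lambda>n. of_real (r n) * z) \<longlonglongrightarrow> of_real 1 * z"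
        by (intro tendsto_intros r_lim)
      ultimately have "(\<lambda>n. h (of_real (r n) * z)) \<longlonglongrightarrow> h z"
        by (intro isCont_tendsto_compose[of z h]) simp_all
      then show ?thesis by (intro tendsto_intros)
    qed
    show ?thesis
      by (rule LIMSEQ_le[OF lower upper]) (use step in blast)
  qed
  have "(\<lambda>d. 2 * pi * M + C * d * B) \<midarrow>0\<rightarrow> 2 * pi * M + C * 0 * B"
    by (intro tendsto_intros)
  then have "((\<lambda>d. 2 * pi * M + C * d * B) \<longlongrightarrow> 2 * pi * M) (at_right 0)"
    by (simp add: filterlim_at_split)
  then have "2 * pi * norm (h z) \<le> 2 * pi * M"
  proof (rule tendsto_lowerbound)
    show "\<forall>\<^sub>F d in at_right 0. 2 * pi * norm (h z) \<le> 2 * pi * M + C * d * B"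
      using eventually_at_right_less by (rule eventually_mono) (rule est)
  qed simp
  then show ?thesis by simp
qed

text \<open>The uniform bound on the circle means is supplied by the sum of the squared coefficient
  norms.\<close>

lemma norm_le_boundary_value:
  assumes "h \<in> hardy_H2"
    and "AE t in lebesgue_on {0..2 * pi}.
      \<forall>e>0. \<forall>\<^sub>F r in at_left (1::real). norm (h (of_real r * cis t)) \<le> M + e"
    and "0 \<le> M" "z \<in> unit_disk"
  shows "norm (h z) \<le> M"
proof -
  have h: "h holomorphic_on unit_disk" "summable (\<lambda>n. (norm (taylor_coeff h n))\<^sup>2)"
    using assms(1) by (auto simp: hardy_H2_def)
  from boundary_maximum_principle[OF h(1) circle_mean_bound[OF taylor_sums[OF h(1)] h(2)] assms(2-4)]
  show ?thesis by blast
qed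

text \<open>Serves for a reciprocal \<open>1 / S\<close>, whose coefficients are not under control
  but which is bounded; the square of that bound controls the circle means.\<close>

lemma norm_le_boundary_value_bounded:
  assumes h: "h holomorphic_on unit_disk" and bound: "\<And>z. z \<in> unit_disk \<Longrightarrow> norm (h z) \<le> K"
    and "AE t in lebesgue_on {0..2 * pi}.
      \<forall>e>0. \<forall>\<^sub>F r in at_left (1::real). norm (h (of_real r * cis t)) \<le> M + e"
    and "0 \<le> M" "z \<in> unit_disk"
  shows "norm (h z) \<le> M"
proof (rule boundary_maximum_principle[OF h _ assms(3-5)])
  fix r :: real assume r: "0 \<le> r" "r < 1"
  have disk: "of_real r * cis t \<in> unit_disk" for t using r by (simp add: norm_mult)
  have cont: "continuous_on {0..2 * pi} (\<lambda>t. (norm (h (of_real r * cis t)))\<^sup>2)"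
    using disk by (intro continuous_intros
        continuous_on_compose2[OF holomorphic_on_imp_continuous_on[OF h]]) auto
  have "integral {0..2 * pi} (\<lambda>t. (norm (h (of_real r * cis t)))\<^sup>2) \<le> integral {0..2 * pi} (\<lambda>t. K\<^sup>2)"
  proof (rule integral_le)
    show "(\<lambda>t. (norm (h (of_real r * cis t)))\<^sup>2) integrable_on {0..2 * pi}"
      by (rule integrable_continuous_real[OF cont])
    show "(norm (h (of_real r * cis t)))\<^sup>2 \<le> K\<^sup>2" for t
      by (rule power_mono[OF bound[OF disk]]) simp
  qed (rule integrable_const_ivl)
  then show "integral {0..2 * pi} (\<lambda>t. (norm (h (of_real r * cis t)))\<^sup>2) \<le> 2 * pi * K\<^sup>2"
    by simp
qed

section \<open>Boundary behaviour and size of inner functions\<close>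

lemma tendsto_imp_eventually_le:
  fixes f :: "'a \<Rightarrow> real"
  assumes "(f \<longlongrightarrow> M) F"
  shows "\<forall>e>0. \<forall>\<^sub>F x in F. f x \<le> M + e"
proof (intro allI impI)
  fix e :: real assume "e > 0"
  then have "\<forall>\<^sub>F x in F. f x < M + e"
    using assms by (intro order_tendstoD(2)) auto
  then show "\<forall>\<^sub>F x in F. f x \<le> M + e" by eventually_elim simp
qed

lemma inner_function_boundary:
  assumes "inner_function \<Theta>"
  shows "AE t in lebesgue_on {0..2 * pi}. ((\<lambda>r. norm (\<Theta> (of_real r * cis t))) \<longlongrightarrow> 1) (at_left (1::real))"
proof -
  have "AE t in lebesgue_on {0..2 * pi}.
      \<exists>l. ((\<lambda>r. \<Theta> (of_real r * cis t)) \<longlongrightarrow> l) (at_left (1::real)) \<and> norm l = 1"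
    using assms unfolding inner_function_def by blast
  then show ?thesis
  proof eventually_elim
    fix t
    assume "\<exists>l. ((\<lambda>r. \<Theta> (of_real r * cis t)) \<longlongrightarrow> l) (at_left (1::real)) \<and> norm l = 1"
    then obtain l where l: "((\<lambda>r. \<Theta> (of_real r * cis t)) \<longlongrightarrow> l) (at_left (1::real))" "norm l = 1"
      by blast
    from tendsto_norm[OF l(1)] show "((\<lambda>r. norm (\<Theta> (of_real r * cis t))) \<longlongrightarrow> 1) (at_left (1::real))"
      unfolding l(2) .
  qed
qed

text \<open>The definition asks only for membership in \<open>hardy_H2\<close>, so boundedness has
  to be derived from the boundary moduli by the maximum principle.\<close>

lemma inner_function_bounded:
  assumes "inner_function \<Theta>" "z \<in> unit_disk"
  shows "norm (\<Theta> z) \<le> 1"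
proof (rule norm_le_boundary_value[of \<Theta> 1 z])
  show "\<Theta> \<in> hardy_H2" using assms(1) by (simp add: inner_function_def)
  show "AE t in lebesgue_on {0..2 * pi}.
      \<forall>e>0. \<forall>\<^sub>F r in at_left (1::real). norm (\<Theta> (of_real r * cis t)) \<le> 1 + e"
    using inner_function_boundary[OF assms(1)] by eventually_elim (rule tendsto_imp_eventually_le)
qed (use assms(2) in auto)

text \<open>If \<open>\<Theta>\<close> vanished, its moduli on almost every radius would tend both
  to 0 and to 1. Almost everywhere anything would follow, in particular the boundary bound 0 for the
  constant function 1, which the maximum principle refutes.\<close>

lemma inner_function_nonzero:
  assumes "inner_function \<Theta>"
  shows "\<exists>z\<in>unit_disk. \<Theta> z \<noteq> 0"
proof (rule ccontr)
  assume "\<not> ?thesis"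
  then have zero: "\<Theta> z = 0" if "z \<in> unit_disk" for z using that by blast
  have "AE t in lebesgue_on {0..2 * pi}.
      \<forall>e>0. \<forall>\<^sub>F r in at_left (1::real). norm (1 :: complex) \<le> 0 + e"
    using inner_function_boundary[OF assms]
  proof eventually_elim
    fix t assume lim: "((\<lambda>r. norm (\<Theta> (of_real r * cis t))) \<longlongrightarrow> 1) (at_left (1::real))"
    have "\<forall>\<^sub>F r in at_left (1::real). r \<in> {0<..<1}"
      by (rule eventually_at_left_real) simp
    then have "\<forall>\<^sub>F r in at_left (1::real). norm (\<Theta> (of_real r * cis t)) = 0"
      by eventually_elim (simp add: zero norm_mult)
    then have "((\<lambda>r. norm (\<Theta> (of_real r * cis t))) \<longlongrightarrow> 0) (at_left (1::real))"
      by (rule tendsto_eventually)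
    from tendsto_unique[OF _ lim this]
    show "\<forall>e>0. \<forall>\<^sub>F r in at_left (1::real). norm (1 :: complex) \<le> 0 + e" by simp
  qed
  from norm_le_boundary_value[OF one_in_hardy_H2 this, of 0] show False by simp
qed

section \<open>The Cesaro operator and moments\<close>

lemma integral_power_unit: "((\<lambda>t::real. of_real t ^ n) has_integral (1 / of_nat (n + 1) :: complex)) {0..1}"
proof -
  have "((\<lambda>t::real. of_real t ^ n) has_integral
      (of_real 1 ^ (n + 1) / of_nat (n + 1) - of_real 0 ^ (n + 1) / of_nat (n + 1) :: complex)) {0..1}"
  proof (rule fundamental_theorem_of_calculus)
    fix t :: real
    have "((\<lambda>w. w ^ (n + 1) / of_nat (n + 1)) has_field_derivative of_real t ^ n) (at (of_real t :: complex))"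
      using of_nat_neq_0[of n, where 'a = complex]
        DERIV_cdivide[OF DERIV_power[OF DERIV_ident, of "n + 1"], of "of_nat (n + 1)"]
      by (simp del: of_nat_Suc)
    from has_vector_derivative_real_field[OF this, of "{0..1}"]
    show "((\<lambda>t. of_real t ^ (n + 1) / of_nat (n + 1) :: complex) has_vector_derivative of_real t ^ n)
        (at t within {0..1})" .
  qed simp
  then show ?thesis by simp
qed

lemma mult_in_unit_disk:
  assumes "0 \<le> t" "t \<le> 1" "z \<in> unit_disk"
  shows "of_real t * z \<in> unit_disk"
proof -
  have "t * norm z \<le> 1 * norm z" using assms by (intro mult_right_mono) auto
  then show ?thesis using assms by (simp add: norm_mult)
qed

text \<open>After telescoping, the \<open>n\<close>-th coefficient is
  \<open>taylor_coeff f n / (n + 1)\<close>, and \<open>1 / (n + 1)\<close> is the integral of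
  \<open>t ^ n\<close> over the unit interval. Absolute convergence at \<open>z\<close> justifies
  exchanging sum and integral.\<close>

lemma cesaro_times_one_minus:
  assumes "f \<in> hardy_H2" "z \<in> unit_disk"
  shows "cesaro (\<lambda>z. (1 - z) * f z) z = integral {0..1} (\<lambda>t. f (of_real t * z))"
proof -
  define b where "b n = taylor_coeff f n * z ^ n" for n
  have hol: "f holomorphic_on unit_disk" using assms(1) by (simp add: hardy_H2_def)
  obtain B where "\<And>n. norm (taylor_coeff f n) \<le> B"
    using l2_bounded assms(1) unfolding hardy_H2_def by blast
  \<comment> \<open>Absolute convergence at \<open>z\<close> is obtained as convergence, at the
    point \<open>norm z\<close>, of the series whose coefficients are the norms.\<close>
  then have "\<And>n. norm (of_real (norm (taylor_coeff f n)) :: complex) \<le> B" by simp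
  from summable_power_series_bounded[OF this, of "of_real (norm z)"]
  have "summable (\<lambda>n. complex_of_real (norm (b n)))"
    using assms(2) by (simp add: b_def norm_mult norm_power)
  then have summ: "summable (\<lambda>n. norm (b n))"
    using summable_of_real_iff by blast
  have int: "((\<lambda>t. \<Sum>n<N. b n * of_real t ^ n) has_integral (\<Sum>n<N. b n * (1 / of_nat (n + 1)))) {0..1}" for N
    by (intro has_integral_sum has_integral_mult_right integral_power_unit) auto
  have "(\<lambda>N. integral {0..1} (\<lambda>t. \<Sum>n<N. b n * of_real t ^ n)) \<longlonglongrightarrow>
      integral {0..1} (\<lambda>t. f (of_real t * z))"
  proof (rule dominated_convergence(2))
    show "(\<lambda>t. \<Sum>n<N. b n * of_real t ^ n) integrable_on {0..1}" for N
      using int by (rule has_integral_integrable)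
    show "(\<lambda>_. \<Sum>n. norm (b n)) integrable_on {0..1::real}" by (rule integrable_const_ivl)
    fix t :: real assume t: "t \<in> {0..1}"
    show "norm (\<Sum>n<N. b n * of_real t ^ n) \<le> (\<Sum>n. norm (b n))" for N
    proof -
      have "norm (\<Sum>n<N. b n * of_real t ^ n) \<le> (\<Sum>n<N. norm (b n * of_real t ^ n))"
        by (rule norm_sum)
      also have "\<dots> \<le> (\<Sum>n<N. norm (b n) * 1)"
        unfolding norm_mult norm_power using t by (intro sum_mono mult_left_mono power_le_one) auto
      also have "\<dots> = (\<Sum>n<N. norm (b n))" by simp
      also have "\<dots> \<le> (\<Sum>n. norm (b n))"
        by (rule sum_le_suminf[OF summ]) auto
      finally show ?thesis .
    qed
    have "of_real t * z \<in> unit_disk" using t assms(2) by (intro mult_in_unit_disk) auto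
    from taylor_sums[OF hol this]
    show "(\<lambda>N. \<Sum>n<N. b n * of_real t ^ n) \<longlonglongrightarrow> f (of_real t * z)"
      by (simp add: b_def sums_def power_mult_distrib mult_ac)
  qed
  moreover have "integral {0..1} (\<lambda>t. \<Sum>n<N. b n * of_real t ^ n) =
      (\<Sum>n<N. cesaro_coeff (\<lambda>z. (1 - z) * f z) n * z ^ n)" for N
    using integral_unique[OF int[of N]]
    unfolding cesaro_coeff_def hardy_H2_times_one_minus(2)[OF assms(1)] by (simp add: b_def mult_ac)
  moreover have "(\<lambda>N. \<Sum>n<N. cesaro_coeff (\<lambda>z. (1 - z) * f z) n * z ^ n) \<longlonglongrightarrow>
      cesaro (\<lambda>z. (1 - z) * f z) z"
    using cesaro_sums[OF hardy_H2_times_one_minus(1)[OF assms(1)] assms(2)] by (simp add: sums_def)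
  ultimately show ?thesis
    using LIMSEQ_unique by auto
qed

text \<open>By Weierstrass, \<open>u\<close> is within \<open>e\<close> of a polynomial
  \<open>g\<close>. Vanishing moments make \<open>u\<close> orthogonal to \<open>g\<close>, so the
  integral of \<open>u\<^sup>2\<close> equals that of \<open>(u - g) * u\<close> and is at most
  \<open>e\<close> times the integral of \<open>\<bar>u\<bar>\<close>; then \<open>e\<close> tends
  to 0.\<close>

lemma moments_zero:
  fixes u :: "real \<Rightarrow> real"
  assumes cont: "continuous_on {0..1} u"
    and moments: "\<And>j. integral {0..1} (\<lambda>t. t ^ j * u t) = 0"
    and t: "t \<in> {0..1}"
  shows "u t = 0"
proof -
  define I where "I = integral {0..1} (\<lambda>t. \<bar>u t\<bar>)"
  have "integral {0..1} (\<lambda>t. (u t)\<^sup>2) \<le> e * I" if e: "e > 0" for e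
  proof -
    obtain g where g: "real_polynomial_function g" "\<And>x. x \<in> {0..1} \<Longrightarrow> \<bar>u x - g x\<bar> < e"
      using Stone_Weierstrass_real_polynomial_function[OF compact_Icc cont e] by blast
    then obtain a n where a: "g = (\<lambda>x. \<Sum>i\<le>n. a i * x ^ i)"
      unfolding real_polynomial_function_iff_sum by blast
    have cont_g: "continuous_on {0..1} g"
      unfolding a by (intro continuous_intros)
    have "((\<lambda>t. \<Sum>i\<le>n. a i * (t ^ i * u t)) has_integral (\<Sum>i\<le>n. a i * 0)) {0..1}"
    proof (intro has_integral_sum has_integral_mult_right)
      show "((\<lambda>t. t ^ i * u t) has_integral 0) {0..1}" for i
        using integrable_integral[OF integrable_continuous_real, of 0 1 "\<lambda>t. t ^ i * u t"] cont
        by (simp add: moments continuous_intros)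
    qed simp
    then have gu: "((\<lambda>t. g t * u t) has_integral 0) {0..1}"
      by (simp add: a sum_distrib_right mult.assoc)
    have "integral {0..1} (\<lambda>t. (u t)\<^sup>2) = integral {0..1} (\<lambda>t. (u t - g t) * u t + g t * u t)"
      by (simp add: power2_eq_square algebra_simps)
    also have "\<dots> = integral {0..1} (\<lambda>t. (u t - g t) * u t)"
      using gu by (subst integral_add)
        (auto intro!: integrable_continuous_real continuous_intros cont cont_g simp: integral_unique)
    also have "\<dots> \<le> integral {0..1} (\<lambda>t. e * \<bar>u t\<bar>)"
    proof (rule integral_le)
      fix x :: real assume "x \<in> {0..1}"
      then have "\<bar>u x - g x\<bar> * \<bar>u x\<bar> \<le> e * \<bar>u x\<bar>"
        using g(2)[of x] by (intro mult_right_mono) auto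
      then show "(u x - g x) * u x \<le> e * \<bar>u x\<bar>"
        using abs_ge_self[of "(u x - g x) * u x"] unfolding abs_mult by linarith
    qed (intro integrable_continuous_real continuous_intros cont cont_g)+
    finally show ?thesis by (simp add: I_def)
  qed
  note le = this
  have "((\<lambda>e. e * I) \<longlongrightarrow> 0 * I) (at_right 0)"
    by (intro tendsto_intros)
  then have "integral {0..1} (\<lambda>t. (u t)\<^sup>2) \<le> 0 * I"
  proof (rule tendsto_lowerbound)
    show "\<forall>\<^sub>F e in at_right 0. integral {0..1} (\<lambda>t. (u t)\<^sup>2) \<le> e * I"
      using eventually_at_right_less by (rule eventually_mono) (rule le)
  qed simp
  moreover have "0 \<le> integral {0..1} (\<lambda>t. (u t)\<^sup>2)"
    by (rule integral_nonneg) (auto intro!: integrable_continuous_real continuous_intros cont)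
  ultimately have "integral {0..1} (\<lambda>t. (u t)\<^sup>2) = 0" by simp
  moreover have "continuous_on {0..1} (\<lambda>t. (u t)\<^sup>2)"
    by (intro continuous_intros cont)
  ultimately have "\<forall>t\<in>{0..1}. (u t)\<^sup>2 = 0"
    using integral_eq_0_iff[of 0 1 "\<lambda>t. (u t)\<^sup>2"] by simp
  then show ?thesis using t by simp
qed

text \<open>The left side is the modulus of the Cesaro image of
  \<open>(1 - z) * z ^ j * \<Theta>\<close>. Invariance provides a quotient \<open>g\<close> by
  \<open>\<Theta>\<close> in \<open>hardy_H2\<close>, even across zeros of \<open>\<Theta>\<close>;
  since the image is bounded by 1, the maximum principle gives
  \<open>norm (g z) \<le> 1\<close>.\<close>

lemma invariant_inner_moment_bound:
  assumes \<Theta>: "inner_function \<Theta>" and inv: "invariant_under cesaro (beurling_subspace \<Theta>)"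
    and z: "z \<in> unit_disk"
  shows "norm (z ^ j * integral {0..1} (\<lambda>t. of_real t ^ j * \<Theta> (of_real t * z))) \<le> norm (\<Theta> z)"
proof -
  have \<Theta>H: "\<Theta> \<in> hardy_H2" using \<Theta> by (simp add: inner_function_def)
  define f where "f z = (1 - z) * (z ^ j * \<Theta> z)" for z
  have "f \<in> beurling_subspace \<Theta>"
    unfolding beurling_subspace_def f_def
    using hardy_H2_times_one_minus(1)[OF hardy_H2_times_power[OF one_in_hardy_H2, of j]]
    by (intro CollectI bexI[of _ "\<lambda>z. (1 - z) * (z ^ j * 1)"]) simp_all
  then have "cesaro f \<in> beurling_subspace \<Theta>"
    using inv unfolding invariant_under_def by blast
  then obtain g where g: "g \<in> hardy_H2" "\<And>w. w \<in> unit_disk \<Longrightarrow> cesaro f w = \<Theta> w * g w"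
    unfolding beurling_subspace_def by blast
  have formula: "cesaro f w = w ^ j * integral {0..1} (\<lambda>t. of_real t ^ j * \<Theta> (of_real t * w))"
    if "w \<in> unit_disk" for w
    using cesaro_times_one_minus[OF hardy_H2_times_power[OF \<Theta>H, of j] that]
    by (simp add: f_def[abs_def] power_mult_distrib mult_ac flip: integral_mult_right)
  have bound: "norm (cesaro f w) \<le> 1" if w: "w \<in> unit_disk" for w
  proof -
    have "norm (integral {0..1} (\<lambda>t. (of_real t * w) ^ j * \<Theta> (of_real t * w))) \<le> 1 * (1 - 0)"
    proof (rule integral_bound)
      have disk: "of_real t * w \<in> unit_disk" if "t \<in> {0..1}" for t
        using that w by (intro mult_in_unit_disk) auto
      have "continuous_on {0..1} (\<lambda>t. \<Theta> (of_real t * w))"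
      proof (rule continuous_on_compose2[of unit_disk \<Theta>])
        show "continuous_on unit_disk \<Theta>"
          using \<Theta>H by (simp add: hardy_H2_def holomorphic_on_imp_continuous_on)
      qed (use disk in \<open>auto intro!: continuous_intros\<close>)
      then show "continuous_on {0..1} (\<lambda>t. (of_real t * w) ^ j * \<Theta> (of_real t * w))"
        by (intro continuous_intros)
      fix t :: real assume "t \<in> {0..1}"
      note disk[OF this]
      then have "norm ((of_real t * w) ^ j) * norm (\<Theta> (of_real t * w)) \<le> 1 * 1"
        using inner_function_bounded[OF \<Theta>, of "of_real t * w"]
        by (intro mult_mono) (auto simp: norm_power intro!: power_le_one)
      then show "norm ((of_real t * w) ^ j * \<Theta> (of_real t * w)) \<le> 1"
        by (simp add: norm_mult)
    qed simp
    then show ?thesis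
      using cesaro_times_one_minus[OF hardy_H2_times_power[OF \<Theta>H, of j] w]
      by (simp add: f_def[abs_def])
  qed
  have "norm (g z) \<le> 1"
  proof (rule norm_le_boundary_value[OF g(1) _ _ z])
    show "AE t in lebesgue_on {0..2 * pi}.
        \<forall>e>0. \<forall>\<^sub>F r in at_left (1::real). norm (g (of_real r * cis t)) \<le> 1 + e"
      using inner_function_boundary[OF \<Theta>]
    proof eventually_elim
      fix t assume lim: "((\<lambda>r. norm (\<Theta> (of_real r * cis t))) \<longlongrightarrow> 1) (at_left (1::real))"
      \<comment> \<open>Along almost every radius \<open>norm g\<close> is at most
        \<open>1 / norm \<Theta>\<close>, which tends to 1; no radial limit of \<open>g\<close>
        itself has to be found.\<close>
      have "((\<lambda>r. 1 / norm (\<Theta> (of_real r * cis t))) \<longlongrightarrow> 1 / 1) (at_left (1::real))"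
        by (intro tendsto_intros lim) simp
      then have le: "\<forall>e>0. \<forall>\<^sub>F r in at_left (1::real). 1 / norm (\<Theta> (of_real r * cis t)) \<le> 1 + e"
        using tendsto_imp_eventually_le by fastforce
      have pos: "\<forall>\<^sub>F r in at_left (1::real). norm (\<Theta> (of_real r * cis t)) > 0"
        by (rule order_tendstoD(1)[OF lim]) simp
      have int: "\<forall>\<^sub>F r in at_left (1::real). r \<in> {0<..<1}"
        by (rule eventually_at_left_real) simp
      show "\<forall>e>0. \<forall>\<^sub>F r in at_left (1::real). norm (g (of_real r * cis t)) \<le> 1 + e"
      proof (intro allI impI)
        fix e :: real assume "e > 0"
        with le have "\<forall>\<^sub>F r in at_left (1::real). 1 / norm (\<Theta> (of_real r * cis t)) \<le> 1 + e" by blast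
        with pos int show "\<forall>\<^sub>F r in at_left (1::real). norm (g (of_real r * cis t)) \<le> 1 + e"
        proof eventually_elim
          fix r :: real
          assume r: "norm (\<Theta> (of_real r * cis t)) > 0" "r \<in> {0<..<1}"
            "1 / norm (\<Theta> (of_real r * cis t)) \<le> 1 + e"
          have disk: "of_real r * cis t \<in> unit_disk" using r(2) by (simp add: norm_mult)
          have "norm (g (of_real r * cis t)) \<le> 1 / norm (\<Theta> (of_real r * cis t))"
            using bound[OF disk] r(1) unfolding g(2)[OF disk] norm_mult by (simp add: field_simps)
          with r(3) show "norm (g (of_real r * cis t)) \<le> 1 + e" by linarith
        qed
      qed
    qed
  qed simp
  then have "norm (\<Theta> z) * norm (g z) \<le> norm (\<Theta> z) * 1"
    by (intro mult_left_mono) auto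
  then show ?thesis
    unfolding formula[OF z, symmetric] g(2)[OF z] norm_mult by simp
qed

section \<open>Rigidity: from invariance to a monomial\<close>

text \<open>
  If \<open>\<Theta>\<close> tends to \<open>0\<close> along a sequence tending to \<open>\<zeta> \<noteq> 0\<close>, in the disk or on the circle,
  then by the moment bound all moments of \<open>\<Theta>\<close> on the radius to \<open>\<zeta>\<close> vanish.
\<close>

lemma invariant_inner_zero_on_radius:
  assumes \<Theta>: "inner_function \<Theta>" and inv: "invariant_under cesaro (beurling_subspace \<Theta>)"
    and z: "\<And>k::nat. z k \<in> unit_disk" "z \<longlonglongrightarrow> \<zeta>" "(\<lambda>k. \<Theta> (z k)) \<longlonglongrightarrow> 0" and \<zeta>: "\<zeta> \<noteq> 0"
    and t: "0 \<le> t" "t < 1"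
  shows "\<Theta> (of_real t * \<zeta>) = 0"
proof -
  have "\<Theta> holomorphic_on unit_disk"
    using \<Theta> by (simp add: inner_function_def hardy_H2_def)
  then have cont: "continuous_on unit_disk \<Theta>"
    by (rule holomorphic_on_imp_continuous_on)
  have "norm \<zeta> \<le> 1"
  proof (rule LIMSEQ_le_const2[OF tendsto_norm[OF z(2)]])
    show "\<exists>N. \<forall>n\<ge>N. norm (z n) \<le> 1" using z(1) by (auto intro: less_imp_le)
  qed
  then have disk: "of_real s * \<zeta> \<in> unit_disk" if "0 \<le> s" "s < 1" for s
    using that mult_left_le[of "norm \<zeta>" s] by (auto simp: norm_mult)
  \<comment> \<open>The endpoint value is set to 0 because \<open>\<zeta>\<close> may lie on the
    circle, where \<open>\<Theta>\<close> is uncontrolled; a single point does not affect the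
    integrals.\<close>
  define g where "g j s = (if s = 1 then 0 else of_real s ^ j * \<Theta> (of_real s * \<zeta>))" for j and s :: real
  have moments: "(g j has_integral 0) {0..1}" for j
  proof -
    define F where "F k s = (if s = 1 then 0 else of_real s ^ j * \<Theta> (of_real s * z k))" for k and s :: real
    have int_f: "(\<lambda>s. of_real s ^ j * \<Theta> (of_real s * z k)) integrable_on {0..1}" for k
    proof (rule integrable_continuous_real)
      have "continuous_on {0..1} (\<lambda>s. \<Theta> (of_real s * z k))"
        by (rule continuous_on_compose2[OF cont])
          (use mult_in_unit_disk[OF _ _ z(1)] in \<open>auto intro!: continuous_intros\<close>)
      then show "continuous_on {0..1} (\<lambda>s. of_real s ^ j * \<Theta> (of_real s * z k))"
        by (intro continuous_intros)
    qed
    have int_F: "F k integrable_on {0..1}" for k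
      by (rule integrable_spike_finite[OF _ _ int_f, of "{1}"]) (auto simp: F_def)
    have F_eq: "integral {0..1} (F k) = integral {0..1} (\<lambda>s. of_real s ^ j * \<Theta> (of_real s * z k))" for k
      by (rule integral_spike[of "{1}"]) (auto simp: F_def)
    have bound: "norm (F k s) \<le> 1" if s: "s \<in> {0..1}" for k s
    proof -
      have "norm (of_real s ^ j :: complex) * norm (\<Theta> (of_real s * z k)) \<le> 1 * 1"
        using s inner_function_bounded[OF \<Theta> mult_in_unit_disk[OF _ _ z(1)[of k]], of s]
        by (intro mult_mono) (auto simp: norm_power intro!: power_le_one)
      then show ?thesis by (simp add: F_def norm_mult)
    qed
    have conv: "(\<lambda>k. F k s) \<longlonglongrightarrow> g j s" if s: "s \<in> {0..1}" for s
    proof (cases "s = 1")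
      case False
      then have "isCont \<Theta> (of_real s * \<zeta>)"
        using s disk[of s] cont by (simp add: continuous_on_eq_continuous_at)
      moreover have "(\<lambda>k. of_real s * z k) \<longlonglongrightarrow> of_real s * \<zeta>"
        by (intro tendsto_intros z(2))
      ultimately have "(\<lambda>k. \<Theta> (of_real s * z k)) \<longlonglongrightarrow> \<Theta> (of_real s * \<zeta>)"
        by (rule isCont_tendsto_compose)
      then show ?thesis
        using False by (simp add: F_def g_def tendsto_mult_left)
    qed (simp add: F_def g_def)
    note conv_int = dominated_convergence[OF int_F integrable_const_ivl[of 1] bound conv]
    \<comment> \<open>The limit is computed twice: by dominated convergence here, and as 0 below by
      squeezing with the moment bound.\<close>
    have "(\<lambda>k. z k ^ j * integral {0..1} (F k)) \<longlonglongrightarrow> \<zeta> ^ j * integral {0..1} (g j)"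
      by (intro tendsto_intros z(2) conv_int(2))
    moreover have "(\<lambda>k. z k ^ j * integral {0..1} (F k)) \<longlonglongrightarrow> 0"
    proof (rule Lim_null_comparison[OF _ tendsto_norm_zero[OF z(3)]])
      show "\<forall>\<^sub>F k in sequentially. norm (z k ^ j * integral {0..1} (F k)) \<le> norm (\<Theta> (z k))"
        unfolding F_eq by (intro always_eventually allI invariant_inner_moment_bound[OF \<Theta> inv z(1)])
    qed
    ultimately have "\<zeta> ^ j * integral {0..1} (g j) = 0"
      by (rule LIMSEQ_unique)
    then have "integral {0..1} (g j) = 0" using \<zeta> by simp
    with integrable_integral[OF conv_int(1)] show ?thesis by simp
  qed
  \<comment> \<open>The factor \<open>1 - s\<close> restores continuity at \<open>s = 1\<close>,
    because \<open>\<Theta>\<close> is bounded by 1. The moments of \<open>w\<close> are differences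
    of consecutive moments of \<open>g\<close>, so they still vanish.\<close>
  define w where "w s = of_real (1 - s) * \<Theta> (of_real s * \<zeta>)" for s :: real
  have w_moments: "((\<lambda>s. of_real s ^ j * w s) has_integral 0) {0..1}" for j
  proof (rule has_integral_eq)
    show "((\<lambda>s. g j s - g (j + 1) s) has_integral 0) {0..1}"
      using has_integral_diff[OF moments[of j] moments[of "j + 1"]] by simp
    show "g j s - g (j + 1) s = of_real s ^ j * w s" for s
      by (simp add: g_def w_def algebra_simps)
  qed
  have w_bound: "norm (w s) \<le> 1 - s" if s: "s \<in> {0..1}" for s
  proof (cases "s = 1")
    case False
    then have "norm (\<Theta> (of_real s * \<zeta>)) \<le> 1"
      using s by (intro inner_function_bounded[OF \<Theta>] disk) auto
    then have "(1 - s) * norm (\<Theta> (of_real s * \<zeta>)) \<le> (1 - s) * 1"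
      using s by (intro mult_left_mono) auto
    then show ?thesis
      using s unfolding w_def norm_mult norm_of_real by simp
  qed (simp add: w_def)
  have w_cont: "continuous_on {0..1} w"
    unfolding continuous_on_def
  proof
    fix s :: real assume s: "s \<in> {0..1}"
    show "(w \<longlongrightarrow> w s) (at s within {0..1})"
    proof (cases "s = 1")
      case True
      have "((\<lambda>s. 1 - s) \<longlongrightarrow> 1 - 1) (at (1::real) within {0..1})"
        by (intro tendsto_intros)
      then have "(w \<longlongrightarrow> 0) (at 1 within {0..1})"
        using w_bound by (intro Lim_null_comparison[of w "\<lambda>s. 1 - s"])
          (auto simp: eventually_at_filter)
      then show ?thesis by (simp add: True w_def)
    next
      case False
      then have "isCont \<Theta> (of_real s * \<zeta>)"
        using s disk[of s] cont by (simp add: continuous_on_eq_continuous_at)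
      then have "isCont (\<lambda>s. \<Theta> (of_real s * \<zeta>)) s"
        by (intro isCont_o2[of s "\<lambda>s. of_real s * \<zeta>" \<Theta>] continuous_intros) auto
      then have "isCont w s"
        unfolding w_def by (intro continuous_intros)
      then show ?thesis
        unfolding isCont_def by (rule tendsto_within_subset) simp
    qed
  qed
  \<comment> \<open>\<open>moments_zero\<close> concerns real functions, so real and imaginary parts
    are treated separately.\<close>
  have "Re (w t) = 0"
  proof (rule moments_zero[of "\<lambda>s. Re (w s)"])
    show "integral {0..1} (\<lambda>s. s ^ j * Re (w s)) = 0" for j
      using integral_unique[OF has_integral_Re[OF w_moments[of j]]] by (simp flip: of_real_power)
  qed (use t w_cont in \<open>auto intro!: continuous_intros\<close>)
  moreover have "Im (w t) = 0"
  proof (rule moments_zero[of "\<lambda>s. Im (w s)"])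
    show "integral {0..1} (\<lambda>s. s ^ j * Im (w s)) = 0" for j
      using integral_unique[OF has_integral_Im[OF w_moments[of j]]] by (simp flip: of_real_power)
  qed (use t w_cont in \<open>auto intro!: continuous_intros\<close>)
  ultimately have "w t = 0" by (simp add: complex_eq_iff)
  then show ?thesis
    using t unfolding w_def mult_eq_0_iff of_real_eq_0_iff by simp
qed

text \<open>The zero at the origin is split off first, since
  \<open>invariant_inner_zero_on_radius\<close> says nothing for \<open>\<zeta> = 0\<close>. The
  remaining factor \<open>S\<close> is bounded away from 0, so both \<open>S\<close> and
  \<open>1 / S\<close> obey the maximum principle with bound 1.\<close>

lemma invariant_inner_imp_monomial:
  assumes \<Theta>: "inner_function \<Theta>" and inv: "invariant_under cesaro (beurling_subspace \<Theta>)"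
  shows "\<exists>(n::nat) c. norm c = 1 \<and> (\<forall>z\<in>unit_disk. \<Theta> z = c * z ^ n)"
proof -
  have \<Theta>H: "\<Theta> \<in> hardy_H2" and hol: "\<Theta> holomorphic_on unit_disk"
    using \<Theta> by (auto simp: inner_function_def hardy_H2_def)
  have ex: "\<exists>n. taylor_coeff \<Theta> n \<noteq> 0"
  proof (rule ccontr)
    assume "\<not> ?thesis"
    then have "\<Theta> z = 0" if "z \<in> unit_disk" for z
      using taylor_sums[OF hol that] by (simp add: sums_iff)
    then show False using inner_function_nonzero[OF \<Theta>] by blast
  qed
  define m where "m = (LEAST n. taylor_coeff \<Theta> n \<noteq> 0)"
  have m: "taylor_coeff \<Theta> m \<noteq> 0" "\<And>n. n < m \<Longrightarrow> taylor_coeff \<Theta> n = 0"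
    unfolding m_def using LeastI_ex[OF ex] not_less_Least by blast+
  obtain S where S: "S holomorphic_on unit_disk" "\<And>n. taylor_coeff S n = taylor_coeff \<Theta> (n + m)"
    "\<And>z. z \<in> unit_disk \<Longrightarrow> \<Theta> z = z ^ m * S z"
    using holomorphic_factor_power[OF hol m(2)] by blast
  have cont: "continuous_on unit_disk S"
    using S(1) by (rule holomorphic_on_imp_continuous_on)
  have S0: "S 0 \<noteq> 0"
    using S(2)[of 0] m(1) by (simp add: taylor_coeff_def fps_expansion_def)
  have cont0: "isCont S 0"
    using cont by (simp add: continuous_on_eq_continuous_at)
  have SH: "S \<in> hardy_H2"
    using \<Theta>H S(1) summable_iff_shift[of "\<lambda>n. (norm (taylor_coeff \<Theta> n))\<^sup>2" m]
    by (simp add: hardy_H2_def S(2))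
  \<comment> \<open>Compactness of the closed disk turns failure of a lower bound into a convergent
    sequence along which \<open>S\<close>, and with it \<open>\<Theta>\<close>, tends to 0; its
    limit may be interior or on the circle.\<close>
  have "\<exists>d>0. \<forall>z\<in>unit_disk. d \<le> norm (S z)"
  proof (rule ccontr)
    assume "\<not> ?thesis"
    then have "\<exists>z\<in>unit_disk. norm (S z) < 1 / (real k + 1)" for k
      by (metis add.commute divide_pos_pos not_le of_nat_0_less_iff of_nat_Suc zero_less_Suc zero_less_one)
    then obtain x where x: "\<And>k. x k \<in> unit_disk" "\<And>k. norm (S (x k)) < 1 / (real k + 1)"
      by metis
    have "\<And>k. x k \<in> cball 0 1" using x(1) by (auto intro: less_imp_le)
    then obtain \<zeta> s where s: "strict_mono s" "(x \<circ> s) \<longlonglongrightarrow> \<zeta>"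
      using compact_cball[of "0 :: complex" 1] unfolding compact_def by blast
    define z where "z k = x (s k)" for k
    have z: "\<And>k. z k \<in> unit_disk" "z \<longlonglongrightarrow> \<zeta>"
      using x(1) s(2) by (simp_all add: z_def[abs_def] o_def)
    have "(\<lambda>k. S (x k)) \<longlonglongrightarrow> 0"
    proof (rule Lim_null_comparison)
      show "\<forall>\<^sub>F k in sequentially. norm (S (x k)) \<le> 1 / (real k + 1)"
        using x(2) by (intro always_eventually allI less_imp_le)
    qed real_asymp
    from LIMSEQ_subseq_LIMSEQ[OF this s(1)]
    have Sz: "(\<lambda>k. S (z k)) \<longlonglongrightarrow> 0" by (simp add: z_def o_def)
    have \<zeta>: "\<zeta> \<noteq> 0"
    proof
      assume "\<zeta> = 0"
      with z(2) cont0 have "(\<lambda>k. S (z k)) \<longlonglongrightarrow> S 0"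
        by (intro isCont_tendsto_compose[of 0 S]) auto
      from LIMSEQ_unique[OF this Sz] S0 show False by simp
    qed
    have "(\<lambda>k. \<Theta> (z k)) \<longlonglongrightarrow> \<zeta> ^ m * 0"
      unfolding S(3)[OF z(1)] by (intro tendsto_intros z(2) Sz)
    then have "(\<lambda>k. \<Theta> (z k)) \<longlonglongrightarrow> 0" by simp
    note zero = invariant_inner_zero_on_radius[OF \<Theta> inv z this \<zeta>]
    have "norm \<zeta> \<le> 1"
    proof (rule LIMSEQ_le_const2[OF tendsto_norm[OF z(2)]])
      show "\<exists>N. \<forall>n\<ge>N. norm (z n) \<le> 1" using z(1) by (auto intro: less_imp_le)
    qed
    \<comment> \<open>Since \<open>\<Theta>\<close> vanishes on the radius to
      \<open>\<zeta>\<close>, so does \<open>S\<close> away from the origin; letting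
      \<open>t\<close> tend to 0 contradicts \<open>S 0 \<noteq> 0\<close>.\<close>
    have "\<forall>\<^sub>F t in at_right (0::real). t \<in> {0<..<1}"
      by (rule eventually_at_right_real) simp
    then have "\<forall>\<^sub>F t in at_right (0::real). S (of_real t * \<zeta>) = 0"
    proof eventually_elim
      fix t :: real assume t: "t \<in> {0<..<1}"
      then have "0 \<le> t" "t < 1" by auto
      then have "t * norm \<zeta> < 1"
        using mult_left_le[OF \<open>norm \<zeta> \<le> 1\<close>, of t] by linarith
      then have "of_real t * \<zeta> \<in> unit_disk"
        using t by (simp add: norm_mult)
      from S(3)[OF this] zero[of t] t \<zeta> show "S (of_real t * \<zeta>) = 0" by simp
    qed
    then have "((\<lambda>t. S (of_real t * \<zeta>)) \<longlongrightarrow> 0) (at_right (0::real))"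
      by (rule tendsto_eventually)
    moreover have "((\<lambda>t. S (of_real t * \<zeta>)) \<longlongrightarrow> S 0) (at_right (0::real))"
    proof (rule isCont_tendsto_compose[OF cont0])
      have "((\<lambda>t. of_real t * \<zeta>) \<longlongrightarrow> of_real 0 * \<zeta>) (at_right (0::real))"
        by (intro tendsto_intros)
      then show "((\<lambda>t. of_real t * \<zeta>) \<longlongrightarrow> 0) (at_right (0::real))" by simp
    qed
    ultimately have "S 0 = 0"
      using tendsto_unique trivial_limit_at_right_real by metis
    with S0 show False by simp
  qed
  then obtain d where d: "d > 0" "\<And>z. z \<in> unit_disk \<Longrightarrow> d \<le> norm (S z)" by blast
  have nz: "S z \<noteq> 0" if "z \<in> unit_disk" for z using d(1) d(2)[OF that] by auto
  have bdry: "AE t in lebesgue_on {0..2 * pi}. ((\<lambda>r. norm (S (of_real r * cis t))) \<longlongrightarrow> 1) (at_left (1::real))"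
    using inner_function_boundary[OF \<Theta>]
  proof eventually_elim
    fix t assume lim: "((\<lambda>r. norm (\<Theta> (of_real r * cis t))) \<longlongrightarrow> 1) (at_left (1::real))"
    \<comment> \<open>Dividing by \<open>r ^ m\<close> preserves the radial limit, because
      \<open>r ^ m\<close> tends to 1.\<close>
    have "((\<lambda>r. norm (\<Theta> (of_real r * cis t)) / r ^ m) \<longlongrightarrow> 1 / 1 ^ m) (at_left (1::real))"
      by (intro tendsto_intros lim) simp
    moreover have "\<forall>\<^sub>F r in at_left (1::real). r \<in> {0<..<1}"
      by (rule eventually_at_left_real) simp
    then have "\<forall>\<^sub>F r in at_left (1::real). norm (\<Theta> (of_real r * cis t)) / r ^ m = norm (S (of_real r * cis t))"
      by eventually_elim (simp add: S(3) norm_mult norm_power)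
    ultimately show "((\<lambda>r. norm (S (of_real r * cis t))) \<longlongrightarrow> 1) (at_left (1::real))"
      using tendsto_cong by force
  qed
  have le: "norm (S z) \<le> 1" if "z \<in> unit_disk" for z
  proof (rule norm_le_boundary_value[OF SH _ _ that])
    show "AE t in lebesgue_on {0..2 * pi}.
        \<forall>e>0. \<forall>\<^sub>F r in at_left (1::real). norm (S (of_real r * cis t)) \<le> 1 + e"
      using bdry by eventually_elim (rule tendsto_imp_eventually_le)
  qed simp
  have ge: "norm (1 / S z) \<le> 1" if "z \<in> unit_disk" for z
  proof (rule norm_le_boundary_value_bounded[of "\<lambda>z. 1 / S z" "1 / d" 1 z])
    show "(\<lambda>z. 1 / S z) holomorphic_on unit_disk"
      using nz by (intro holomorphic_intros S(1)) auto
    show "norm (1 / S w) \<le> 1 / d" if "w \<in> unit_disk" for w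
      using d(1) d(2)[OF that] by (simp add: norm_divide frac_le)
    show "AE t in lebesgue_on {0..2 * pi}.
        \<forall>e>0. \<forall>\<^sub>F r in at_left (1::real). norm (1 / S (of_real r * cis t)) \<le> 1 + e"
      using bdry
    proof eventually_elim
      fix t assume lim: "((\<lambda>r. norm (S (of_real r * cis t))) \<longlongrightarrow> 1) (at_left (1::real))"
      have "((\<lambda>r. 1 / norm (S (of_real r * cis t))) \<longlongrightarrow> 1 / 1) (at_left (1::real))"
        by (intro tendsto_intros lim) simp
      then have "((\<lambda>r. norm (1 / S (of_real r * cis t))) \<longlongrightarrow> 1) (at_left (1::real))"
        by (simp add: norm_divide)
      then show "\<forall>e>0. \<forall>\<^sub>F r in at_left (1::real). norm (1 / S (of_real r * cis t)) \<le> 1 + e"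
        by (rule tendsto_imp_eventually_le)
    qed
  qed (use that in auto)
  have eq: "norm (S z) = 1" if "z \<in> unit_disk" for z
    using le[OF that] ge[OF that] nz[OF that] by (simp add: norm_divide)
  \<comment> \<open>The modulus is 1 throughout, so it attains its maximum at the interior point
    0.\<close>
  have "S constant_on unit_disk"
    by (rule maximum_modulus_principle[OF S(1), of unit_disk 0]) (auto simp: eq)
  then obtain c where c: "\<And>z. z \<in> unit_disk \<Longrightarrow> S z = c"
    unfolding constant_on_def by blast
  have "norm c = 1" using eq[of 0] c[of 0] by simp
  moreover have "\<Theta> z = c * z ^ m" if "z \<in> unit_disk" for z
    using S(3)[OF that] c[OF that] by simp
  ultimately show ?thesis by blast
qed

theorem corollary9:
  fixes \<Theta> :: "complex \<Rightarrow> complex"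
  assumes "inner_function \<Theta>"
  shows "invariant_under cesaro (beurling_subspace \<Theta>) \<longleftrightarrow>
    (\<exists>(n::nat) (c::complex). norm c = 1 \<and> (\<forall>z\<in>unit_disk. \<Theta> z = c * z ^ n))"
  using invariant_inner_imp_monomial[OF assms] invariant_beurling_monomial by blast

end
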